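(* Let $f(\vec{x},\cdot)\in C^2(\mathbb{R})$ for every grid point $\vec{x}$, and let $$F^h(U)=A_h\operatorname{vec}(U)+N_h(\vec{x},U),\qquad N_h(\vec{x},U)=\operatorname{vec}([f(\vec{x},U)]),$$ where $A_h$ is a symmetric positive definite matrix. Denote by $(N_h)_U(U)=(N_h)_U(\vec{x},U)$ the Jacobian of $N_h$ with respect to $U$. Let $U^\ast$ satisfy $F^h(U^\ast)=0$, and suppose that $(N_h)_U$ is symmetric positive definite near $U^\ast$, i.e. there is a neighborhood of $U^\ast$ such that $(N_h)_U(U)$ is symmetric positive definite for every $U$ in it. Then the iterative scheme $$\operatorname{vec}(U_{n+1})=\operatorname{vec}(U_n)-[A_h+\beta_n I]^{-1}F^h(U_n),\qquad n\ge 0,$$ with $$\beta_n=\frac{\lambda_{\max}\big((N_h)_U(U_n)\big)+\lambda_{\min}\big((N_h)_U(U_n)\big)}{2},$$ where $\lambda_{\max}((N_h)_U(U_n))$ and $\lambda_{\min}((N_h)_U(U_n))$ are the maximum and minimum eigenvalues of $(N_h)_U(U_n)$, converges locally to $U^\ast$: there exists $\epsilon>0$ such that for every $U_0$ with $\|U^\ast-U_0\|_{L^2}\le\epsilon$ the iterates $U_n$ are well defined and $\|U^\ast-U_n\|_{L^2}\to 0$ as $n\to\infty$.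
   Context: The setting is a discretization, on a fixed finite tensor-product grid in a bounded rectangular domain $\Omega\subset\mathbb{R}^d$ with $d=2$ or $d=3$, of the equation $-\Delta u+\lambda u+f(x,u)=0$, where $f:\Omega\times\mathbb{R}\to\mathbb{R}$ is a given nonlinear function. The unknown $U$ is the array of real grid values: $U=(U_{i,j})$ (an $N_x\times N_y$ matrix) when $d=2$, or $U=(U_{i,j,k})$ (an $N_x\times N_y\times N_z$ tensor) when $d=3$. The operator $\operatorname{vec}$ stacks the entries of such an array into a column vector of length $N$, the total number of entries. $A_h$ is a real $N\times N$ matrix (the discretized linear operator) and $I$ is the $N\times N$ identity. The nonlinear term is evaluated pointwise on the grid: $N_h(\vec{x},U)=\operatorname{vec}([f(x_i,y_j,U_{i,j})])$ for $d=2$ and $N_h(\vec{x},U)=\operatorname{vec}([f(x_i,y_j,z_k,U_{i,j,k})])$ for $d=3$, where $(x_i,y_j)$, respectively $(x_i,y_j,z_k)$, are the grid points. Hence $(N_h)_U(\vec{x},U)$, the Jacobian of $N_h$ with respect to $\operatorname{vec}(U)$, is the $N\times N$ diagonal matrix whose diagonal entries are the derivatives of $f$ in its last argument at the grid points and corresponding values of $U$. The norm is $\|U\|_{L^2}=\big(\operatorname{vec}(U)^\top(M_y\otimes M_x)\operatorname{vec}(U)\big)^{1/2}$ for $d=2$ and $\|U\|_{L^2}=\big(\operatorname{vec}(U)^\top(M_z\otimes M_y\otimes M_x)\operatorname{vec}(U)\big)^{1/2}$ for $d=3$, where $M_x,M_y,M_z$ are the one-dimensional mass matrices, which are fixed diagonal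 matrices with positive diagonal entries, and $\otimes$ is the Kronecker product. *)

theory Defs
  imports "HOL-Analysis.Analysis"
begin

section \<open>Matrices\<close>

definition sym_pos_def :: "real^'n^'n \<Rightarrow> bool" where
  "sym_pos_def A \<longleftrightarrow> transpose A = A \<and> (\<forall>v. v \<noteq> 0 \<longrightarrow> v \<bullet> (A *v v) > 0)"

definition pos_diagonal :: "real^'n^'n \<Rightarrow> bool" where
  "pos_diagonal M \<longleftrightarrow> (\<forall>i j. i \<noteq> j \<longrightarrow> M $ i $ j = 0) \<and> (\<forall>i. M $ i $ i > 0)"

definition eigenvalues :: "real^'n^'n \<Rightarrow> real set" where
  "eigenvalues A = {l. \<exists>v. v \<noteq> 0 \<and> A *v v = l *\<^sub>R v}"

definition lambda_max :: "real^'n^'n \<Rightarrow> real" where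
  "lambda_max A = Max (eigenvalues A)"

definition lambda_min :: "real^'n^'n \<Rightarrow> real" where
  "lambda_min A = Min (eigenvalues A)"

definition kronecker :: "real^'b^'a \<Rightarrow> real^'d^'c \<Rightarrow> real^('b \<times> 'd)^('a \<times> 'c)" where
  "kronecker A B = (\<chi> p. \<chi> q. A $ fst p $ fst q * B $ snd p $ snd q)"

definition C2 :: "(real \<Rightarrow> real) \<Rightarrow> bool" where
  "C2 g \<longleftrightarrow> (\<forall>u. g differentiable (at u)) \<and> (\<forall>u. deriv g differentiable (at u)) \<and>
     continuous_on UNIV (deriv (deriv g))"

section \<open>Grid arrays\<close>

text \<open>
  The index types \<^typ>\<open>'x\<close>, \<^typ>\<open>'y\<close>, \<^typ>\<open>'z\<close> have \<open>N\<^sub>x\<close>, \<open>N\<^sub>y\<close>, \<open>N\<^sub>z\<close> elements, and an array has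
  entries \<open>U $ i $ j\<close>, respectively \<open>U $ i $ j $ k\<close>. The stacked vector is indexed by
  \<open>(j, i)\<close>, respectively \<open>(k, j, i)\<close>: this is column-major stacking, where the first array index
  varies fastest, and it matches the index types of \<open>M\<^sub>y \<otimes> M\<^sub>x\<close> and \<open>M\<^sub>z \<otimes> (M\<^sub>y \<otimes> M\<^sub>x)\<close>.
\<close>

definition vec2 :: "real^'y^'x \<Rightarrow> real^('y \<times> 'x)" where
  "vec2 U = (\<chi> p. case p of (j, i) \<Rightarrow> U $ i $ j)"

definition vec3 :: "real^'z^'y^'x \<Rightarrow> real^('z \<times> 'y \<times> 'x)" where
  "vec3 U = (\<chi> p. case p of (k, j, i) \<Rightarrow> U $ i $ j $ k)"

definition Nh2 :: "(real \<times> real \<Rightarrow> real \<Rightarrow> real) \<Rightarrow> real^'x \<Rightarrow> real^'y \<Rightarrow>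
    real^'y^'x \<Rightarrow> real^('y \<times> 'x)" where
  "Nh2 f x y U = vec2 (\<chi> i. \<chi> j. f (x $ i, y $ j) (U $ i $ j))"

definition Nh3 :: "(real \<times> real \<times> real \<Rightarrow> real \<Rightarrow> real) \<Rightarrow> real^'x \<Rightarrow> real^'y \<Rightarrow> real^'z \<Rightarrow>
    real^'z^'y^'x \<Rightarrow> real^('z \<times> 'y \<times> 'x)" where
  "Nh3 f x y z U = vec3 (\<chi> i. \<chi> j. \<chi> k. f (x $ i, y $ j, z $ k) (U $ i $ j $ k))"

definition L2norm2 :: "real^'x^'x \<Rightarrow> real^'y^'y \<Rightarrow> real^'y^'x \<Rightarrow> real" where
  "L2norm2 Mx My U = sqrt (vec2 U \<bullet> (kronecker My Mx *v vec2 U))"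

definition L2norm3 :: "real^'x^'x \<Rightarrow> real^'y^'y \<Rightarrow> real^'z^'z \<Rightarrow> real^'z^'y^'x \<Rightarrow> real" where
  "L2norm3 Mx My Mz U = sqrt (vec3 U \<bullet> (kronecker Mz (kronecker My Mx) *v vec3 U))"

lemma bij_vec2: "bij vec2"
proof (rule bijI')
  show "vec2 U = vec2 V \<longleftrightarrow> U = V" for U V :: "real^'y^'x"
    by (auto simp: vec2_def vec_eq_iff)
  show "\<exists>U. v = vec2 U" for v :: "real^('y::finite \<times> 'x::finite)"
    by (rule exI[of _ "\<chi> i. \<chi> j. v $ (j, i)"]) (auto simp: vec2_def vec_eq_iff)
qed

lemma bij_vec3: "bij vec3"
proof (rule bijI')
  show "vec3 U = vec3 V \<longleftrightarrow> U = V" for U V :: "real^'z^'y^'x"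
    by (auto simp: vec3_def vec_eq_iff)
  show "\<exists>U. v = vec3 U" for v :: "real^('z::finite \<times> 'y::finite \<times> 'x::finite)"
    by (rule exI[of _ "\<chi> i. \<chi> j. \<chi> k. v $ (k, j, i)"]) (auto simp: vec3_def vec_eq_iff)
qed

section \<open>The iterative scheme\<close>

text \<open>
  The parameter \<open>vc\<close> is the stacking map, \<^const>\<open>vec2\<close> or \<^const>\<open>vec3\<close>. As it is a bijection,
  \<open>inv vc\<close> turns a stacked vector back into the array it comes from.
\<close>

definition Fh :: "('u \<Rightarrow> real^'n) \<Rightarrow> real^'n^'n \<Rightarrow> ('u \<Rightarrow> real^'n) \<Rightarrow> 'u \<Rightarrow> real^'n" where
  "Fh vc A Nh U = A *v vc U + Nh U"

definition jacobian_vec :: "('u \<Rightarrow> real^'n) \<Rightarrow> ('u \<Rightarrow> real^'n) \<Rightarrow> 'u \<Rightarrow> real^'n^'n" where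
  "jacobian_vec vc Nh U = jacobian (\<lambda>v. Nh (inv vc v)) (at (vc U))"

definition beta :: "('u \<Rightarrow> real^'n) \<Rightarrow> ('u \<Rightarrow> real^'n) \<Rightarrow> 'u \<Rightarrow> real" where
  "beta vc Nh U =
     (lambda_max (jacobian_vec vc Nh U) + lambda_min (jacobian_vec vc Nh U)) / 2"

definition shifted :: "('u \<Rightarrow> real^'n) \<Rightarrow> real^'n^'n \<Rightarrow> ('u \<Rightarrow> real^'n) \<Rightarrow> 'u \<Rightarrow> real^'n^'n" where
  "shifted vc A Nh U = A + mat (beta vc Nh U)"

text \<open>
  \<^const>\<open>matrix_inv\<close> is total, so the iterates below are the intended ones only as long as
  all matrices \<^const>\<open>shifted\<close> are invertible.
\<close>

primrec iterates :: "('u \<Rightarrow> real^'n) \<Rightarrow> real^'n^'n \<Rightarrow> ('u \<Rightarrow> real^'n) \<Rightarrow> 'u \<Rightarrow> nat \<Rightarrow> 'u" where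
  "iterates vc A Nh U0 0 = U0"
| "iterates vc A Nh U0 (Suc n) = (let U = iterates vc A Nh U0 n in
     inv vc (vc U - matrix_inv (shifted vc A Nh U) *v Fh vc A Nh U))"

lemma vec_iterates_Suc:
  assumes "bij vc"
  shows "vc (iterates vc A Nh U0 (Suc n)) = vc (iterates vc A Nh U0 n) -
    matrix_inv (shifted vc A Nh (iterates vc A Nh U0 n)) *v Fh vc A Nh (iterates vc A Nh U0 n)"
  using assms by (simp add: Let_def bij_is_surj surj_f_inv_f)

end

theory Submission
  imports Defs
begin

text \<open>
  Write \<open>u = vec U\<^sup>*\<close>, \<open>v = vec U\<^sub>n\<close> and \<open>\<beta> = \<beta>\<^sub>n\<close>. Since \<open>A u + N u = 0\<close>, one step of the scheme turns
  the error \<open>u - v\<close> into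
  \<open>(A + \<beta> I)\<inverse> (\<beta> (u - v) - (N u - N v))\<close>,
  and the two factors can be estimated separately.

  \<^item> As \<open>A\<close> is positive definite, \<open>A + \<beta> I\<close> dominates \<open>\<beta> I\<close>, so its inverse has Euclidean operator norm
  at most \<open>1 / \<beta>\<close> (lemma \<open>sym_pos_def_shift_lower_bound\<close>).

  \<^item> As \<open>N\<close> acts entrywise, the mean value theorem gives \<open>N u - N v = D (u - v)\<close> with a diagonal matrix
  \<open>D\<close> whose entries are close to those of the Jacobian at \<open>U\<^sup>*\<close>. If the latter have minimum
  \<open>m > 0\<close> and maximum \<open>M\<close>, then \<open>\<beta>\<close> is close to the midpoint \<open>(M + m) / 2\<close>, and the entries of
  \<open>\<beta> I - D\<close> are bounded by about \<open>(M - m) / 2\<close>.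

  Near \<open>U\<^sup>*\<close> each step therefore multiplies the error by at most about \<open>(M - m) / (M + m) < 1\<close> in the
  Euclidean norm (lemma \<open>scheme_step_contracts_near_solution\<close>). So the iterates never leave a small ball around \<open>U\<^sup>*\<close>,
  where \<open>\<beta> > 0\<close> makes all shifted matrices invertible, and they converge geometrically. The weighted
  norm is equivalent to the Euclidean one because the Kronecker product of positive diagonal matrices
  is again positive diagonal.
  The dimension of the grid enters only through the bijective linear stacking map, so both cases are
  instances of \<open>scheme_converges_locally\<close>.
\<close>

section \<open>Diagonal matrices\<close>

lemma diagonal_mult_vec_nth:
  fixes D :: "real^'n^'n"
  assumes "\<forall>i j. i \<noteq> j \<longrightarrow> D $ i $ j = 0"
  shows "(D *v v) $ i = D $ i $ i * v $ i"
proof -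
  have *: "D $ i $ j * v $ j = (if j = i then D $ i $ i * v $ i else 0)" for j
    using assms by auto
  have "(D *v v) $ i = (\<Sum>j\<in>UNIV. if j = i then D $ i $ i * v $ i else 0)"
    unfolding matrix_vector_mult_def vec_lambda_beta by (intro sum.cong refl *)
  then show ?thesis by simp
qed

lemma eigenvalues_diagonal:
  fixes D :: "real^'n^'n"
  assumes "\<forall>i j. i \<noteq> j \<longrightarrow> D $ i $ j = 0"
  shows "eigenvalues D = range (\<lambda>i. D $ i $ i)"
proof (intro equalityI subsetI)
  fix l assume "l \<in> eigenvalues D"
  then obtain v where "v \<noteq> 0" and v: "D *v v = l *\<^sub>R v"
    by (auto simp: eigenvalues_def)
  then obtain i where "v $ i \<noteq> 0" by (auto simp: vec_eq_iff)
  have "D $ i $ i * v $ i = l * v $ i"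
    using diagonal_mult_vec_nth[OF assms, of v i] by (simp only: v vector_scaleR_component real_scaleR_def)
  then have "l = D $ i $ i" using \<open>v $ i \<noteq> 0\<close> by simp
  then show "l \<in> range (\<lambda>i. D $ i $ i)" by auto
next
  fix l assume "l \<in> range (\<lambda>i. D $ i $ i)"
  then obtain i where i: "l = D $ i $ i" by blast
  have "D *v axis i 1 = l *\<^sub>R axis i 1"
    by (auto simp: vec_eq_iff diagonal_mult_vec_nth[OF assms] i axis_def)
  moreover have "axis i (1::real) \<noteq> 0" by (simp add: axis_eq_0_iff)
  ultimately show "l \<in> eigenvalues D" unfolding eigenvalues_def by blast
qed

lemma sym_pos_def_diagonal_entry:
  fixes A :: "real^'n^'n"
  assumes "sym_pos_def A"
  shows "A $ i $ i > 0"
proof -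
  have "axis i (1::real) \<noteq> 0" by (simp add: axis_eq_0_iff)
  then have "axis i 1 \<bullet> (A *v axis i 1) > 0" using assms by (simp add: sym_pos_def_def)
  then show ?thesis by (simp add: inner_axis' matrix_vector_mult_basis column_def)
qed

lemma pos_diagonal_kronecker:
  assumes "pos_diagonal A" and "pos_diagonal B"
  shows "pos_diagonal (kronecker A B)"
  using assms unfolding pos_diagonal_def kronecker_def by (auto simp: prod_eq_iff)

text \<open>
  The weighted norm controls the Euclidean one, so that a starting value that is close in the
  weighted norm lies in the Euclidean ball where the scheme contracts. The smallest weight \<open>m\<close>
  gives the constant \<open>sqrt m\<close>.
\<close>

lemma pos_diagonal_norm_bound:
  fixes M :: "real^'n^'n"
  assumes "pos_diagonal M"
  obtains c where "c > 0" and "\<And>v. c * norm v \<le> sqrt (v \<bullet> (M *v v))"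
proof
  define m where "m = Min (range (\<lambda>i. M $ i $ i))"
  have "m \<in> range (\<lambda>i. M $ i $ i)" unfolding m_def by (rule Min_in) auto
  then have "m > 0" using assms by (auto simp: pos_diagonal_def)
  then show "sqrt m > 0" by simp
  show "sqrt m * norm v \<le> sqrt (v \<bullet> (M *v v))" for v
  proof -
    have "m * (v \<bullet> v) = (\<Sum>i\<in>UNIV. m * (v $ i * v $ i))"
      by (simp add: inner_vec_def sum_distrib_left)
    also have "\<dots> \<le> (\<Sum>i\<in>UNIV. M $ i $ i * (v $ i * v $ i))"
      by (intro sum_mono mult_right_mono) (auto simp: m_def)
    also have "\<dots> = v \<bullet> (M *v v)"
      using assms by (simp add: inner_vec_def diagonal_mult_vec_nth pos_diagonal_def algebra_simps)
    finally show ?thesis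
      by (simp add: norm_eq_sqrt_inner flip: real_sqrt_mult)
  qed
qed

section \<open>Pointwise nonlinearities\<close>

lemma jacobian_pointwise:
  fixes g :: "'n::finite \<Rightarrow> real \<Rightarrow> real" and v :: "real^'n"
  assumes "\<And>p. g p differentiable (at (v $ p))"
  shows "jacobian (\<lambda>w. \<chi> p. g p (w $ p)) (at v) $ p $ q
    = (if p = q then deriv (g p) (v $ p) else 0)"
proof -
  let ?N = "\<lambda>w. \<chi> p. g p (w $ p)" and ?D = "\<lambda>h. \<chi> p. deriv (g p) (v $ p) * h $ p"
  have "(?N has_derivative ?D) (at v)"
  proof (subst has_derivative_componentwise_within, intro ballI)
    fix b :: "real^'n" assume "b \<in> Basis"
    then obtain p where b: "b = axis p 1" by (auto simp: Basis_vec_def)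
    have "(g p has_derivative (*) (deriv (g p) (v $ p))) (at (v $ p))"
      using assms[of p] by (metis DERIV_deriv_iff_real_differentiable has_field_derivative_def)
    from has_derivative_compose[OF bounded_linear_imp_has_derivative[OF bounded_linear_vec_nth] this]
    show "((\<lambda>w. ?N w \<bullet> b) has_derivative (\<lambda>h. ?D h \<bullet> b)) (at v)"
      by (simp add: b inner_axis)
  qed
  then have "frechet_derivative ?N (at v) = ?D" by (rule frechet_derivative_at[symmetric])
  then show ?thesis
    unfolding jacobian_def matrix_def by (simp only: vec_lambda_beta axis_def) simp
qed

text \<open>
  Maximum and minimum may be attained at different indices for \<open>d\<close> and \<open>d'\<close>, but both are
  \<open>1\<close>-Lipschitz in the supremum norm. This makes the shift \<open>\<beta>\<close> depend continuously on the iterate.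
\<close>

lemma midrange_perturbation:
  fixes d d' :: "'n::finite \<Rightarrow> real"
  assumes "\<And>p. \<bar>d' p - d p\<bar> \<le> \<eta>"
  shows "\<bar>(Max (range d') + Min (range d')) / 2 - (Max (range d) + Min (range d)) / 2\<bar> \<le> \<eta>"
proof -
  have *: "Max (range a) \<le> Max (range b) + \<eta> \<and> Min (range a) \<le> Min (range b) + \<eta>"
    if "\<And>p. a p \<le> b p + \<eta>" for a b :: "'n \<Rightarrow> real"
  proof
    have "a p \<le> Max (range b) + \<eta>" for p
      using that[of p] by (rule order_trans) simp
    then show "Max (range a) \<le> Max (range b) + \<eta>" by (subst Max_le_iff) auto
    have "Min (range b) \<in> range b" by (rule Min_in) auto
    then obtain p where "Min (range b) = b p" by blast
    moreover have "Min (range a) \<le> a p" by (rule Min_le) auto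
    ultimately show "Min (range a) \<le> Min (range b) + \<eta>"
      using that[of p] by linarith
  qed
  have "d' p \<le> d p + \<eta>" "d p \<le> d' p + \<eta>" for p using assms[of p] by auto
  from *[of d' d, OF this(1)] *[of d d', OF this(2)] show ?thesis
    unfolding abs_le_iff by (auto simp del: Max_le_iff Min_le_iff simp: field_simps)
qed

text \<open>
  Mean value estimate. The intermediate points of the individual entries form one vector that is
  entrywise closer to \<open>u\<close> than \<open>v\<close> is, so it lies in every ball around \<open>u\<close> that contains \<open>v\<close>; there the
  derivatives are controlled.
\<close>

lemma pointwise_mean_value_bound:
  fixes g :: "'n::finite \<Rightarrow> real \<Rightarrow> real" and u v :: "real^'n"
  assumes diff: "\<And>p s. g p differentiable (at s)"
    and bound: "\<And>w p. norm (w - u) \<le> norm (v - u) \<Longrightarrow> \<bar>\<beta> - deriv (g p) (w $ p)\<bar> \<le> K"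
  shows "norm (\<beta> *\<^sub>R (u - v) - ((\<chi> p. g p (u $ p)) - (\<chi> p. g p (v $ p)))) \<le> K * norm (u - v)"
proof -
  have deriv: "(g p has_real_derivative deriv (g p) s) (at s)" for p s
    using diff by (simp add: DERIV_deriv_iff_real_differentiable)
  have "\<exists>s. \<bar>s - u $ p\<bar> \<le> \<bar>v $ p - u $ p\<bar> \<and>
      g p (u $ p) - g p (v $ p) = deriv (g p) s * (u $ p - v $ p)" for p
  proof (cases "u $ p" "v $ p" rule: linorder_cases)
    case less
    from MVT2[OF less deriv] obtain s where "u $ p < s" "s < v $ p"
      and "g p (v $ p) - g p (u $ p) = (v $ p - u $ p) * deriv (g p) s" by blast
    then show ?thesis by (intro exI[of _ s]) (auto simp: algebra_simps)
  next
    case greater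
    from MVT2[OF greater deriv] obtain s where "v $ p < s" "s < u $ p"
      and "g p (u $ p) - g p (v $ p) = (u $ p - v $ p) * deriv (g p) s" by blast
    then show ?thesis by (intro exI[of _ s]) (auto simp: algebra_simps)
  qed auto
  then obtain s where s: "\<And>p. \<bar>s p - u $ p\<bar> \<le> \<bar>v $ p - u $ p\<bar>"
      "\<And>p. g p (u $ p) - g p (v $ p) = deriv (g p) (s p) * (u $ p - v $ p)"
    by metis
  have "norm ((\<chi> p. s p) - u) \<le> norm (v - u)"
    by (rule norm_le_componentwise_cart) (simp add: s)
  then have K: "\<bar>\<beta> - deriv (g p) (s p)\<bar> \<le> K" for p
    using bound[of "\<chi> p. s p" p] by simp
  from K have "K \<ge> 0" by (meson abs_ge_zero order_trans)
  have "norm (\<beta> *\<^sub>R (u - v) - ((\<chi> p. g p (u $ p)) - (\<chi> p. g p (v $ p)))) \<le> norm (K *\<^sub>R (u - v))"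
  proof (rule norm_le_componentwise_cart)
    fix p
    have "(\<beta> *\<^sub>R (u - v) - ((\<chi> p. g p (u $ p)) - (\<chi> p. g p (v $ p)))) $ p
        = (\<beta> - deriv (g p) (s p)) * (u $ p - v $ p)"
      using s(2)[of p] by (simp add: algebra_simps)
    then show "norm ((\<beta> *\<^sub>R (u - v) - ((\<chi> p. g p (u $ p)) - (\<chi> p. g p (v $ p)))) $ p)
        \<le> norm ((K *\<^sub>R (u - v)) $ p)"
      using K[of p] \<open>K \<ge> 0\<close> by (simp add: abs_mult mult_right_mono)
  qed
  then show ?thesis using \<open>K \<ge> 0\<close> by simp
qed

section \<open>The contraction estimate\<close>

lemma mat_scaleR_vec: "mat c *v v = c *\<^sub>R (v :: real^'n)"
  by (simp add: vec_eq_iff diagonal_mult_vec_nth mat_def)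

text \<open>
  Pair \<open>(A + \<beta> I) w\<close> with \<open>w\<close>: the term with \<open>A\<close> is nonnegative and can be dropped, and Cauchy-Schwarz
  bounds the pairing from above.
\<close>

lemma sym_pos_def_shift_lower_bound:
  fixes A :: "real^'n^'n"
  assumes "sym_pos_def A"
  shows "\<beta> * norm w \<le> norm ((A + mat \<beta>) *v w)"
proof (cases "w = 0")
  case False
  have "\<beta> * norm w * norm w = w \<bullet> (\<beta> *\<^sub>R w)"
    by (simp add: dot_square_norm power2_eq_square)
  also have "\<dots> \<le> w \<bullet> ((A + mat \<beta>) *v w)"
    using assms False
    by (auto simp: sym_pos_def_def matrix_vector_mult_add_rdistrib mat_scaleR_vec inner_add_right less_imp_le)
  also have "\<dots> \<le> norm ((A + mat \<beta>) *v w) * norm w"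
    by (subst mult.commute) (rule norm_cauchy_schwarz)
  finally show ?thesis using False by simp
qed simp

lemma invertible_sym_pos_def_shift:
  fixes A :: "real^'n^'n"
  assumes "sym_pos_def A" and "\<beta> > 0"
  shows "invertible (A + mat \<beta>)"
proof -
  have "w = 0" if "(A + mat \<beta>) *v w = 0" for w
    using sym_pos_def_shift_lower_bound[OF assms(1), of \<beta> w] that assms(2)
    by (simp add: mult_le_0_iff)
  then show ?thesis
    by (metis invertible_left_inverse matrix_left_invertible_ker)
qed

text \<open>
  Here \<open>y\<close> and \<open>z\<close> are the values of the nonlinear term at the solution \<open>u\<close> and at the iterate \<open>v\<close>.
  Multiplying the new error by \<open>A + \<beta> I\<close> and using \<open>A u = - y\<close> cancels \<open>A\<close> altogether and leaves
  \<open>\<beta> (u - v) - (y - z)\<close>, so the bound on the rate depends only on how well \<open>\<beta> I\<close> fits the nonlinear term.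
\<close>

lemma sym_pos_def_shift_contraction:
  fixes A :: "real^'n^'n"
  assumes A: "sym_pos_def A" and "\<beta> > 0" and zero: "A *v u + y = 0"
    and bound: "norm (\<beta> *\<^sub>R (u - v) - (y - z)) \<le> K * norm (u - v)"
  shows "norm (u - (v - matrix_inv (A + mat \<beta>) *v (A *v v + z))) \<le> K / \<beta> * norm (u - v)"
proof -
  let ?B = "A + mat \<beta>"
  let ?e = "u - (v - matrix_inv ?B *v (A *v v + z))"
  have "?B ** matrix_inv ?B = mat 1"
    using invertible_sym_pos_def_shift[OF A \<open>\<beta> > 0\<close>]
    unfolding invertible_def matrix_inv_def by (metis (mono_tags, lifting) someI_ex)
  then have "?B *v (matrix_inv ?B *v y) = y" for y
    by (simp only: matrix_vector_mul_assoc matrix_vector_mul_lid)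
  then have "?B *v ?e = ?B *v (u - v) + (A *v v + z)"
    by (simp only: matrix_vector_mult_diff_distrib) simp
  also have "\<dots> = \<beta> *\<^sub>R (u - v) - (y - z)"
  proof -
    have "A *v u = - y" using zero by (simp add: add_eq_0_iff2)
    then show ?thesis
      by (simp add: matrix_vector_mult_add_rdistrib matrix_vector_mult_diff_distrib mat_scaleR_vec
          scaleR_diff_right)
  qed
  finally have "\<beta> * norm ?e \<le> K * norm (u - v)"
    using sym_pos_def_shift_lower_bound[OF A, of \<beta> ?e] bound by simp
  then show ?thesis using \<open>\<beta> > 0\<close> by (simp add: field_simps)
qed

text \<open>
  The Jacobian of a pointwise map is diagonal, so its eigenvalues are the derivatives of the entries
  and \<open>\<beta>\<close> is their midrange.
\<close>

lemma beta_pointwise: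
  fixes vc :: "'u \<Rightarrow> real^'n"
  assumes "bij vc" and Nh: "\<And>U. Nh U = (\<chi> p. g p (vc U $ p))"
    and diff: "\<And>p s. g p differentiable (at s)"
  shows "beta vc Nh U = (Max (range (\<lambda>p. deriv (g p) (vc U $ p)))
    + Min (range (\<lambda>p. deriv (g p) (vc U $ p)))) / 2"
    and "jacobian_vec vc Nh U $ p $ p = deriv (g p) (vc U $ p)"
proof -
  have "(\<lambda>v. Nh (inv vc v)) = (\<lambda>v. \<chi> p. g p (v $ p))"
    using \<open>bij vc\<close> by (simp add: Nh bij_is_surj surj_f_inv_f)
  then have J: "jacobian_vec vc Nh U $ p $ q = (if p = q then deriv (g p) (vc U $ p) else 0)" for p q
    by (simp add: jacobian_vec_def jacobian_pointwise diff)
  then show "jacobian_vec vc Nh U $ p $ p = deriv (g p) (vc U $ p)" by simp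
  have "eigenvalues (jacobian_vec vc Nh U) = range (\<lambda>p. deriv (g p) (vc U $ p))"
    by (subst eigenvalues_diagonal) (simp_all add: J)
  then show "beta vc Nh U = (Max (range (\<lambda>p. deriv (g p) (vc U $ p)))
    + Min (range (\<lambda>p. deriv (g p) (vc U $ p)))) / 2"
    by (simp add: beta_def lambda_max_def lambda_min_def)
qed

text \<open>
  With \<open>\<eta>\<close> bounding the variation of the derivatives near \<open>U\<^sup>*\<close>, the contraction factor is
  \<open>((M - m) / 2 + 2 \<eta>) / ((M + m) / 2 - \<eta>)\<close>,
  where \<open>m\<close> and \<open>M\<close> are the extreme derivatives at \<open>U\<^sup>*\<close>. It is below \<open>1\<close> as soon as \<open>3 \<eta> < m\<close>, which
  explains the choice \<open>\<eta> = m / 4\<close>. In the proof, \<open>c\<close> is the midpoint and \<open>h\<close> half the spread of the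
  derivatives at \<open>U\<^sup>*\<close>.
\<close>

lemma scheme_step_contracts_near_solution:
  fixes vc :: "'u \<Rightarrow> real^'n"
  assumes vc: "bij vc" and Nh: "\<And>U. Nh U = (\<chi> p. g p (vc U $ p))"
    and diff: "\<And>p s. g p differentiable (at s)"
    and cont: "\<And>p s. isCont (deriv (g p)) s"
    and A: "sym_pos_def A" and zero: "Fh vc A Nh Ustar = 0"
    and J: "sym_pos_def (jacobian_vec vc Nh Ustar)"
  obtains r \<rho> where "r > 0" and "0 \<le> \<rho>" and "\<rho> < 1"
    and "\<And>U. norm (vc Ustar - vc U) < r \<Longrightarrow> invertible (shifted vc A Nh U)"
    and "\<And>U. norm (vc Ustar - vc U) < r \<Longrightarrow>
      norm (vc Ustar - (vc U - matrix_inv (shifted vc A Nh U) *v Fh vc A Nh U))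
        \<le> \<rho> * norm (vc Ustar - vc U)"
proof -
  define u where "u = vc Ustar"
  define d where "d w p = deriv (g p) (w $ p)" for w p
  define M m \<eta> where "M = Max (range (d u))" and "m = Min (range (d u))" and "\<eta> = m / 4"
  have beta: "beta vc Nh U = (Max (range (d (vc U))) + Min (range (d (vc U)))) / 2" for U
    using beta_pointwise(1)[where g = g, OF vc Nh diff] by (simp add: d_def[abs_def])
  have "d u p > 0" for p
    using sym_pos_def_diagonal_entry[OF J, of p] beta_pointwise(2)[where g = g, OF vc Nh diff, of Ustar p]
    by (simp add: d_def u_def)
  moreover have "m \<in> range (d u)" unfolding m_def by (rule Min_in) auto
  ultimately have "m > 0" by auto
  then have "\<eta> > 0" by (simp add: \<eta>_def)
  have range: "m \<le> d u p" "d u p \<le> M" for p by (auto simp: m_def M_def)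
  then have "m \<le> M" using order_trans by blast
  have "\<forall>\<^sub>F w in nhds u. \<forall>p. \<bar>d w p - d u p\<bar> < \<eta>"
  proof (rule eventually_all_finite)
    fix p
    have "((\<lambda>w. d w p) \<longlongrightarrow> d u p) (nhds u)"
      unfolding d_def by (rule isCont_tendsto_compose[OF cont tendsto_vec_nth[OF filterlim_ident]])
    from tendstoD[OF this \<open>\<eta> > 0\<close>] show "\<forall>\<^sub>F w in nhds u. \<bar>d w p - d u p\<bar> < \<eta>"
      by (simp add: dist_real_def)
  qed
  then obtain r where "r > 0" and r: "\<And>w p. norm (w - u) < r \<Longrightarrow> \<bar>d w p - d u p\<bar> < \<eta>"
    unfolding eventually_nhds_metric dist_norm by blast
  define c h where "c = (M + m) / 2" and "h = (M - m) / 2"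
  have \<beta>: "\<bar>beta vc Nh U - c\<bar> \<le> \<eta>" if "norm (u - vc U) < r" for U
    unfolding beta c_def M_def m_def
    using r[of "vc U"] that by (intro midrange_perturbation) (auto simp: norm_minus_commute less_imp_le)
  have "c - \<eta> > 0" and "h \<ge> 0" and "h + 2 * \<eta> < c - \<eta>"
    using \<open>m \<le> M\<close> \<open>m > 0\<close> by (auto simp: c_def h_def \<eta>_def field_simps)
  show ?thesis
  proof (rule that[of r "(h + 2 * \<eta>) / (c - \<eta>)"])
    show "r > 0" by fact
    show "0 \<le> (h + 2 * \<eta>) / (c - \<eta>)" using \<open>c - \<eta> > 0\<close> \<open>h \<ge> 0\<close> \<open>\<eta> > 0\<close> by simp
    show "(h + 2 * \<eta>) / (c - \<eta>) < 1" using \<open>c - \<eta> > 0\<close> \<open>h + 2 * \<eta> < c - \<eta>\<close> by simp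
  next
    fix U assume U: "norm (vc Ustar - vc U) < r"
    then have "beta vc Nh U > 0" using \<beta>[of U] \<open>c - \<eta> > 0\<close> by (auto simp: u_def)
    then show "invertible (shifted vc A Nh U)"
      unfolding shifted_def by (rule invertible_sym_pos_def_shift[OF A])
  next
    fix U assume U: "norm (vc Ustar - vc U) < r"
    let ?\<beta> = "beta vc Nh U" and ?N = "\<lambda>w. \<chi> p. g p (w $ p)"
    have "c - \<eta> \<le> ?\<beta>" using \<beta>[of U] U by (auto simp: u_def)
    then have "?\<beta> > 0" using \<open>c - \<eta> > 0\<close> by linarith
    have "norm (?\<beta> *\<^sub>R (u - vc U) - (?N u - ?N (vc U))) \<le> (h + 2 * \<eta>) * norm (u - vc U)"
    proof (rule pointwise_mean_value_bound[OF diff])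
      fix w p assume "norm (w - u) \<le> norm (vc U - u)"
      then have "\<bar>d w p - d u p\<bar> < \<eta>" using U by (intro r) (auto simp: u_def norm_minus_commute)
      moreover have "\<bar>c - d u p\<bar> \<le> h" using range[of p] by (auto simp: c_def h_def abs_le_iff field_simps)
      ultimately show "\<bar>?\<beta> - deriv (g p) (w $ p)\<bar> \<le> h + 2 * \<eta>"
        using \<beta>[of U] U by (fold d_def) (auto simp: u_def)
    qed
    from sym_pos_def_shift_contraction[OF A \<open>?\<beta> > 0\<close> _ this]
    have "norm (u - (vc U - matrix_inv (shifted vc A Nh U) *v Fh vc A Nh U))
        \<le> (h + 2 * \<eta>) / ?\<beta> * norm (u - vc U)"
      using zero by (simp add: Fh_def Nh shifted_def u_def)
    also have "\<dots> \<le> (h + 2 * \<eta>) / (c - \<eta>) * norm (u - vc U)"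
      using \<open>c - \<eta> \<le> ?\<beta>\<close> \<open>c - \<eta> > 0\<close> \<open>h \<ge> 0\<close> \<open>\<eta> > 0\<close>
      by (intro mult_right_mono divide_left_mono) auto
    finally show "norm (vc Ustar - (vc U - matrix_inv (shifted vc A Nh U) *v Fh vc A Nh U))
        \<le> (h + 2 * \<eta>) / (c - \<eta>) * norm (vc Ustar - vc U)" by (simp add: u_def)
  qed
qed

section \<open>Local convergence\<close>

lemma C2_D:
  assumes "C2 g"
  shows "g differentiable (at s)" and "isCont (deriv g) s"
  using assms unfolding C2_def by (auto intro: differentiable_imp_continuous_within)

text \<open>
  The contraction keeps all iterates in the Euclidean ball of radius \<open>r\<close>, where it can be applied
  again, so the error decays like \<open>\<rho> ^ n\<close>. The weighted norm enters only at the two ends: to place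
  the starting value in the ball, and to transfer the limit by continuity.
\<close>

lemma scheme_converges_locally:
  fixes vc :: "'u::ab_group_add \<Rightarrow> real^'n" and M :: "real^'n^'n"
  assumes vc: "bij vc" and vc_diff: "\<And>U V. vc (U - V) = vc U - vc V"
    and Nh: "\<And>U. Nh U = (\<chi> p. g p (vc U $ p))" and C2: "\<And>p. C2 (g p)"
    and A: "sym_pos_def A" and zero: "Fh vc A Nh Ustar = 0"
    and J: "sym_pos_def (jacobian_vec vc Nh Ustar)" and M: "pos_diagonal M"
  defines "L \<equiv> \<lambda>U. sqrt (vc U \<bullet> (M *v vc U))"
  shows "\<exists>\<epsilon>>0. \<forall>U0. L (Ustar - U0) \<le> \<epsilon> \<longrightarrow>
    (\<forall>n. invertible (shifted vc A Nh (iterates vc A Nh U0 n))) \<and>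
    (\<lambda>n. L (Ustar - iterates vc A Nh U0 n)) \<longlonglongrightarrow> 0"
proof -
  obtain r \<rho> where "r > 0" and \<rho>: "0 \<le> \<rho>" "\<rho> < 1"
    and inv: "\<And>U. norm (vc Ustar - vc U) < r \<Longrightarrow> invertible (shifted vc A Nh U)"
    and step: "\<And>U. norm (vc Ustar - vc U) < r \<Longrightarrow>
      norm (vc Ustar - (vc U - matrix_inv (shifted vc A Nh U) *v Fh vc A Nh U))
        \<le> \<rho> * norm (vc Ustar - vc U)"
    using scheme_step_contracts_near_solution[OF vc Nh C2_D[OF C2] A zero J] by metis
  obtain c where "c > 0" and c: "\<And>v. c * norm v \<le> sqrt (v \<bullet> (M *v v))"
    using pos_diagonal_norm_bound[OF M] by blast
  show ?thesis
    \<comment> \<open>Halving turns the closed ball of starting values into a subset of the open ball of radius \<open>r\<close>.\<close>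
  proof (intro exI[of _ "c * r / 2"] conjI allI impI)
    show "c * r / 2 > 0" using \<open>c > 0\<close> \<open>r > 0\<close> by simp
  next
    fix U0
    let ?U = "iterates vc A Nh U0"
    assume "L (Ustar - U0) \<le> c * r / 2"
    then have "c * norm (vc Ustar - vc U0) \<le> c * (r / 2)"
      using c[of "vc Ustar - vc U0"] by (simp add: L_def vc_diff)
    then have U0: "norm (vc Ustar - vc U0) < r" using \<open>c > 0\<close> \<open>r > 0\<close> by simp
    have err: "norm (vc Ustar - vc (?U n)) \<le> \<rho> ^ n * norm (vc Ustar - vc U0)" for n
    proof (induction n)
      case (Suc n)
      have "\<rho> ^ n * norm (vc Ustar - vc U0) \<le> norm (vc Ustar - vc U0)"
        using \<rho> by (intro mult_left_le_one_le power_le_one) auto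
      with Suc U0 have "norm (vc Ustar - vc (?U n)) < r" by linarith
      from step[OF this] have "norm (vc Ustar - vc (?U (Suc n))) \<le> \<rho> * norm (vc Ustar - vc (?U n))"
        by (subst vec_iterates_Suc[OF vc])
      also have "\<dots> \<le> \<rho> * (\<rho> ^ n * norm (vc Ustar - vc U0))"
        using Suc \<rho> by (intro mult_left_mono)
      finally show ?case by (simp add: mult.assoc)
    qed simp
    show "invertible (shifted vc A Nh (?U n))" for n
    proof (rule inv)
      have "\<rho> ^ n * norm (vc Ustar - vc U0) \<le> norm (vc Ustar - vc U0)"
        using \<rho> by (intro mult_left_le_one_le power_le_one) auto
      with err[of n] U0 show "norm (vc Ustar - vc (?U n)) < r" by linarith
    qed
    have "(\<lambda>n. \<rho> ^ n * norm (vc Ustar - vc U0)) \<longlonglongrightarrow> 0"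
      using \<rho> by (intro tendsto_mult_left_zero LIMSEQ_realpow_zero)
    then have "(\<lambda>n. vc Ustar - vc (?U n)) \<longlonglongrightarrow> 0"
      by (rule Lim_null_comparison[rotated]) (simp add: err)
    then have "(\<lambda>n. sqrt ((vc Ustar - vc (?U n)) \<bullet> (M *v (vc Ustar - vc (?U n)))))
        \<longlonglongrightarrow> sqrt (0 \<bullet> (M *v 0))"
      by (intro tendsto_intros bounded_linear.tendsto[OF matrix_vector_mul_bounded_linear])
    then show "(\<lambda>n. L (Ustar - ?U n)) \<longlonglongrightarrow> 0" by (simp add: L_def vc_diff)
  qed
qed

theorem theorem1:
  shows
  "(\<forall>(a :: real \<times> real) (b :: real \<times> real) (x :: real^'x) (y :: real^'y)
      (Mx :: real^'x^'x) (My :: real^'y^'y)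
      (f :: real \<times> real \<Rightarrow> real \<Rightarrow> real)
      (A :: real^('y \<times> 'x)^('y \<times> 'x)) (Ustar :: real^'y^'x).
      box a b \<noteq> {} \<longrightarrow>
      (\<forall>i j. (x $ i, y $ j) \<in> cbox a b) \<longrightarrow>
      pos_diagonal Mx \<longrightarrow> pos_diagonal My \<longrightarrow>
      (\<forall>i j. C2 (f (x $ i, y $ j))) \<longrightarrow>
      sym_pos_def A \<longrightarrow>
      Fh vec2 A (Nh2 f x y) Ustar = 0 \<longrightarrow>
      (\<exists>S. open S \<and> Ustar \<in> S \<and> (\<forall>U\<in>S. sym_pos_def (jacobian_vec vec2 (Nh2 f x y) U))) \<longrightarrow>
      (\<exists>\<epsilon>>0. \<forall>U0. L2norm2 Mx My (Ustar - U0) \<le> \<epsilon> \<longrightarrow>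
         (\<forall>n. invertible (shifted vec2 A (Nh2 f x y) (iterates vec2 A (Nh2 f x y) U0 n))) \<and>
         (\<lambda>n. L2norm2 Mx My (Ustar - iterates vec2 A (Nh2 f x y) U0 n)) \<longlonglongrightarrow> 0))
   \<and>
   (\<forall>(a :: real \<times> real \<times> real) (b :: real \<times> real \<times> real)
      (x :: real^'x) (y :: real^'y) (z :: real^'z)
      (Mx :: real^'x^'x) (My :: real^'y^'y) (Mz :: real^'z^'z)
      (f :: real \<times> real \<times> real \<Rightarrow> real \<Rightarrow> real)
      (A :: real^('z \<times> 'y \<times> 'x)^('z \<times> 'y \<times> 'x)) (Ustar :: real^'z^'y^'x).
      box a b \<noteq> {} \<longrightarrow>
      (\<forall>i j k. (x $ i, y $ j, z $ k) \<in> cbox a b) \<longrightarrow>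
      pos_diagonal Mx \<longrightarrow> pos_diagonal My \<longrightarrow> pos_diagonal Mz \<longrightarrow>
      (\<forall>i j k. C2 (f (x $ i, y $ j, z $ k))) \<longrightarrow>
      sym_pos_def A \<longrightarrow>
      Fh vec3 A (Nh3 f x y z) Ustar = 0 \<longrightarrow>
      (\<exists>S. open S \<and> Ustar \<in> S \<and> (\<forall>U\<in>S. sym_pos_def (jacobian_vec vec3 (Nh3 f x y z) U))) \<longrightarrow>
      (\<exists>\<epsilon>>0. \<forall>U0. L2norm3 Mx My Mz (Ustar - U0) \<le> \<epsilon> \<longrightarrow>
         (\<forall>n. invertible (shifted vec3 A (Nh3 f x y z) (iterates vec3 A (Nh3 f x y z) U0 n))) \<and>
         (\<lambda>n. L2norm3 Mx My Mz (Ustar - iterates vec3 A (Nh3 f x y z) U0 n)) \<longlonglongrightarrow> 0))"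
proof (intro conjI allI impI)
  fix x :: "real^'x" and y :: "real^'y" and Mx :: "real^'x^'x" and My :: "real^'y^'y"
    and f :: "real \<times> real \<Rightarrow> real \<Rightarrow> real"
    and A :: "real^('y \<times> 'x)^('y \<times> 'x)" and Ustar :: "real^'y^'x"
  let ?N = "Nh2 f x y" and ?g = "\<lambda>(j, i). f (x $ i, y $ j)"
  assume M: "pos_diagonal Mx" "pos_diagonal My" and C2: "\<forall>i j. C2 (f (x $ i, y $ j))"
    and A: "sym_pos_def A" and zero: "Fh vec2 A ?N Ustar = 0"
    and J: "\<exists>S. open S \<and> Ustar \<in> S \<and> (\<forall>U\<in>S. sym_pos_def (jacobian_vec vec2 ?N U))"
  have J': "sym_pos_def (jacobian_vec vec2 ?N Ustar)" using J by blast
  show "\<exists>\<epsilon>>0. \<forall>U0. L2norm2 Mx My (Ustar - U0) \<le> \<epsilon> \<longrightarrow>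
      (\<forall>n. invertible (shifted vec2 A ?N (iterates vec2 A ?N U0 n))) \<and>
      (\<lambda>n. L2norm2 Mx My (Ustar - iterates vec2 A ?N U0 n)) \<longlonglongrightarrow> 0"
    unfolding L2norm2_def using C2
    by (intro scheme_converges_locally[where g = ?g] bij_vec2 A zero J' pos_diagonal_kronecker M)
      (auto simp: vec2_def Nh2_def vec_eq_iff)
next
  fix x :: "real^'x" and y :: "real^'y" and z :: "real^'z"
    and Mx :: "real^'x^'x" and My :: "real^'y^'y" and Mz :: "real^'z^'z"
    and f :: "real \<times> real \<times> real \<Rightarrow> real \<Rightarrow> real"
    and A :: "real^('z \<times> 'y \<times> 'x)^('z \<times> 'y \<times> 'x)" and Ustar :: "real^'z^'y^'x"
  let ?N = "Nh3 f x y z" and ?g = "\<lambda>(k, j, i). f (x $ i, y $ j, z $ k)"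
  assume M: "pos_diagonal Mx" "pos_diagonal My" "pos_diagonal Mz"
    and C2: "\<forall>i j k. C2 (f (x $ i, y $ j, z $ k))"
    and A: "sym_pos_def A" and zero: "Fh vec3 A ?N Ustar = 0"
    and J: "\<exists>S. open S \<and> Ustar \<in> S \<and> (\<forall>U\<in>S. sym_pos_def (jacobian_vec vec3 ?N U))"
  have J': "sym_pos_def (jacobian_vec vec3 ?N Ustar)" using J by blast
  show "\<exists>\<epsilon>>0. \<forall>U0. L2norm3 Mx My Mz (Ustar - U0) \<le> \<epsilon> \<longrightarrow>
      (\<forall>n. invertible (shifted vec3 A ?N (iterates vec3 A ?N U0 n))) \<and>
      (\<lambda>n. L2norm3 Mx My Mz (Ustar - iterates vec3 A ?N U0 n)) \<longlonglongrightarrow> 0"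
    unfolding L2norm3_def using C2
    by (intro scheme_converges_locally[where g = ?g] bij_vec3 A zero J' pos_diagonal_kronecker M)
      (auto simp: vec3_def Nh3_def vec_eq_iff)
qed

end
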